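(* Let $I\subseteq\mathbb{R}$ be a nondegenerate interval with $\inf I=0$, and let $\mathcal{M}\colon\bigcup_{n=1}^\infty I^n\to I$ be a symmetric, Jensen-concave, and repetition superinvariant mean on $I$. Then for all $n\in\mathbb{N}$ $$\mathcal{H}_n(\mathcal{M})\le n\cdot \mathop{\mathcal{M}_\#}_{i=1}^{n}\Big(\frac1i,(n-1)!\Big).$$ In particular $$\mathcal{H}(\mathcal{M})\le\liminf_{n\to\infty}\; n\cdot \mathop{\mathcal{M}_\#}_{i=1}^{n}\Big(\frac1i,(n-1)!\Big).$$
   Context: Let $\mathbb{N}=\{1,2,\dots\}$, $\mathbb{R}_+=(0,\infty)$. A mean on $I$ is a function $\mathcal{M}\colon\bigcup_{n=1}^\infty I^n\to I$ with $\min(x)\le\mathcal{M}(x)\le\max(x)$ for every $x\in\bigcup_n I^n$. $\mathcal{M}$ is symmetric if, for all $n$, its value on $I^n$ is invariant under permutations of the $n$ entries. $\mathcal{M}$ is Jensen concave if for every $n$ the restriction $\mathcal{M}|_{I^n}$ is Jensen (midpoint) concave, i.e. $\mathcal{M}\big(\frac{x+y}2\big)\ge\frac{\mathcal{M}(x)+\mathcal{M}(y)}2$ for $x,y\in I^n$. $\mathcal{M}$ is repetition superinvariant if for all $n,m\in\mathbb{N}$ and $(x_1,\dots,x_n)\in I^n$, $$\mathcal{M}(\underbrace{x_1,\dots,x_1}_{m\text{ times}},\dots,\underbrace{x_n,\dots,x_n}_{m\text{ times}})\ge\mathcal{M}(x_1,\dots,x_n).$$ Hardy constants: $\mathcal{H}(\mathcal{M})$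 is the smallest extended real number $C$ such that $\sum_{n=1}^\infty\mathcal{M}(x_1,\dots,x_n)\le C\sum_{n=1}^\infty x_n$ for all summable sequences $(x_n)_{n=1}^\infty$ with entries in $I$. For $n\in\mathbb{N}$, $\mathcal{H}_n(\mathcal{M})$ is the smallest nonnegative number such that $\mathcal{M}(x_1)+\mathcal{M}(x_1,x_2)+\dots+\mathcal{M}(x_1,\dots,x_n)\le\mathcal{H}_n(\mathcal{M})(x_1+\dots+x_n)$ for all $(x_1,\dots,x_n)\in I^n$. Homogenization: $\mathcal{M}_\#\colon\bigcup_{n=1}^\infty\mathbb{R}_+^n\to\mathbb{R}_+$ is defined by $\mathcal{M}_\#(x):=\liminf_{t\to0^+}\frac1t\mathcal{M}(tx)$ (note $tx\in I^n$ for all small $t>0$). Notation: for a mean $\mathcal{K}$, entries $x_1,\dots,x_n$ in its interval and nonnegative integers $\lambda_1,\dots,\lambda_n$ not all zero, $\mathop{\mathcal{K}}_{i=1}^{n}(x_i,\lambda_i):=\mathcal{K}(\underbrace{x_1,\dots,x_1}_{\lambda_1\text{ times}},\dots,\underbrace{x_n,\dots,x_n}_{\lambda_n\text{ times}})$. Here it is used with $\mathcal{K}=\mathcal{M}_\#$. *)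

theory Defs
  imports "HOL-Analysis.Analysis"
begin

text \<open>
  A tuple in the disjoint union of the powers of I is a nonempty list with entries in I.
  A function on this union is modelled by a total function on lists, and its values outside
  the domain are never used.
\<close>

definition tuples :: "real set \<Rightarrow> real list set" where
  "tuples I = {x. x \<noteq> [] \<and> set x \<subseteq> I}"

definition is_mean :: "real set \<Rightarrow> (real list \<Rightarrow> real) \<Rightarrow> bool" where
  "is_mean I M \<longleftrightarrow>
     (\<forall>x\<in>tuples I. M x \<in> I \<and> Min (set x) \<le> M x \<and> M x \<le> Max (set x))"

definition symmetric_mean :: "real set \<Rightarrow> (real list \<Rightarrow> real) \<Rightarrow> bool" where
  "symmetric_mean I M \<longleftrightarrow> (\<forall>x\<in>tuples I. \<forall>y. mset y = mset x \<longrightarrow> M y = M x)"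

definition jensen_concave_mean :: "real set \<Rightarrow> (real list \<Rightarrow> real) \<Rightarrow> bool" where
  "jensen_concave_mean I M \<longleftrightarrow>
     (\<forall>x\<in>tuples I. \<forall>y\<in>tuples I. length x = length y \<longrightarrow>
        M (map2 (\<lambda>a b. (a + b) / 2) x y) \<ge> (M x + M y) / 2)"

definition repetition_superinvariant :: "real set \<Rightarrow> (real list \<Rightarrow> real) \<Rightarrow> bool" where
  "repetition_superinvariant I M \<longleftrightarrow>
     (\<forall>x\<in>tuples I. \<forall>m\<ge>1. M (concat (map (replicate m) x)) \<ge> M x)"

text \<open>
  Sequences are indexed from 0, so the n-th summand is the mean of the first n + 1 entries.
  For a mean on an interval with infimum 0 the two infima below are attained, as shown by
  the lemmas following them.
\<close>

definition hardy_const :: "real set \<Rightarrow> (real list \<Rightarrow> real) \<Rightarrow> ereal" where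
  "hardy_const I M = Inf {C::ereal. \<forall>x::nat \<Rightarrow> real. range x \<subseteq> I \<and> summable x \<longrightarrow>
     (\<Sum>n. ereal (M (map x [0..<Suc n]))) \<le> C * ereal (\<Sum>n. x n)}"

definition hardy_const_n :: "real set \<Rightarrow> (real list \<Rightarrow> real) \<Rightarrow> nat \<Rightarrow> real" where
  "hardy_const_n I M n = Inf {C::real. 0 \<le> C \<and> (\<forall>x\<in>tuples I. length x = n \<longrightarrow>
     (\<Sum>k=1..n. M (take k x)) \<le> C * sum_list x)}"

text \<open>
  The limit inferior is taken in the extended reals. For a mean and a tuple of positive
  numbers it is finite, see \<open>homogenization_Liminf\<close> below.
\<close>

definition homogenization :: "(real list \<Rightarrow> real) \<Rightarrow> real list \<Rightarrow> real" where
  "homogenization M x =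
     real_of_ereal (Liminf (at_right 0) (\<lambda>t. ereal (1 / t * M (map (\<lambda>a. t * a) x))))"

definition repeated_mean ::
    "(real list \<Rightarrow> real) \<Rightarrow> nat \<Rightarrow> (nat \<Rightarrow> real) \<Rightarrow> (nat \<Rightarrow> nat) \<Rightarrow> real" where
  "repeated_mean K n x l = K (concat (map (\<lambda>i. replicate (l i) (x i)) [1..<Suc n]))"

lemma is_mean_bounds:
  assumes "is_mean I M" "x \<noteq> []" "set x \<subseteq> I" "\<And>a. a \<in> set x \<Longrightarrow> l \<le> a" "\<And>a. a \<in> set x \<Longrightarrow> a \<le> u"
  shows "l \<le> M x" "M x \<le> u"
proof -
  have *: "Min (set x) \<le> M x" "M x \<le> Max (set x)"
    using assms(1-3) by (auto simp: is_mean_def tuples_def)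
  have "Min (set x) \<in> set x" "Max (set x) \<in> set x"
    using assms(2) by auto
  then show "l \<le> M x" "M x \<le> u"
    using assms(4)[of "Min (set x)"] assms(5)[of "Max (set x)"] * by linarith+
qed

lemma hardy_const_n_least:
  assumes I: "I \<subseteq> {0..}" and M: "is_mean I M"
  shows "0 \<le> hardy_const_n I M n"
    and "\<And>x. x \<in> tuples I \<Longrightarrow> length x = n \<Longrightarrow>
           (\<Sum>k=1..n. M (take k x)) \<le> hardy_const_n I M n * sum_list x"
proof -
  define A where "A = {C::real. 0 \<le> C \<and> (\<forall>x\<in>tuples I. length x = n \<longrightarrow>
     (\<Sum>k=1..n. M (take k x)) \<le> C * sum_list x)}"
  have H: "hardy_const_n I M n = Inf A" by (simp add: hardy_const_n_def A_def)
  have pos: "0 \<le> sum_list x" if "x \<in> tuples I" for x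
    using that I by (intro sum_list_nonneg) (auto simp: tuples_def)
  have "real n \<in> A"
    unfolding A_def
  proof (intro CollectI conjI ballI impI)
    fix x assume x: "x \<in> tuples I" "length x = n"
    have "M (take k x) \<le> sum_list x" if "k \<in> {1..n}" for k
    proof (rule is_mean_bounds[OF M])
      show "take k x \<noteq> []" using x that by (auto simp: tuples_def)
      show "set (take k x) \<subseteq> I" using x set_take_subset[of k x] by (auto simp: tuples_def)
      then show "0 \<le> a" if "a \<in> set (take k x)" for a using that I by auto
      show "a \<le> sum_list x" if "a \<in> set (take k x)" for a
        using that x I set_take_subset[of k x]
        by (intro member_le_sum_list) (auto simp: tuples_def)
    qed
    then have "(\<Sum>k=1..n. M (take k x)) \<le> (\<Sum>k=1..n. sum_list x)" by (intro sum_mono) auto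
    then show "(\<Sum>k=1..n. M (take k x)) \<le> real n * sum_list x" by simp
  qed simp
  then have ne: "A \<noteq> {}" by auto
  show "0 \<le> hardy_const_n I M n"
    unfolding H using ne by (intro cInf_greatest) (auto simp: A_def)
  fix x assume x: "x \<in> tuples I" "length x = n"
  show "(\<Sum>k=1..n. M (take k x)) \<le> hardy_const_n I M n * sum_list x"
  proof (cases "sum_list x = 0")
    case True
    then show ?thesis using ne x by (auto simp: A_def)
  next
    case False
    then have s: "0 < sum_list x" using pos[OF x(1)] by simp
    have "(\<Sum>k=1..n. M (take k x)) / sum_list x \<le> Inf A"
      using x s by (intro cInf_greatest ne) (auto simp: A_def divide_simps)
    then show ?thesis using s by (simp add: H divide_simps)
  qed
qed

lemma hardy_const_least:
  assumes I: "I \<subseteq> {0..}" and M: "is_mean I M" and x: "range x \<subseteq> I" "summable x"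
  shows "(\<Sum>n. ereal (M (map x [0..<Suc n]))) \<le> hardy_const I M * ereal (\<Sum>n. x n)"
proof -
  have nn: "0 \<le> x n" for n using x I by auto
  show ?thesis
  proof (cases "(\<Sum>n. x n) = 0")
    case True
    then have "x n = 0" for n using suminf_eq_zero_iff[OF x(2) nn] by simp
    then have "M (map x [0..<Suc n]) \<le> 0" for n
      using x by (intro is_mean_bounds(2)[OF M, where l = 0]) auto
    moreover have "0 \<le> M (map x [0..<Suc n])" for n
      using x nn by (intro is_mean_bounds(1)[OF M, where u = "Max (set (map x [0..<Suc n]))"]) auto
    ultimately have "M (map x [0..<Suc n]) = 0" for n by (metis order_antisym)
    then have "(\<Sum>n. ereal (M (map x [0..<Suc n]))) = 0"
      by (simp add: zero_ereal_def[symmetric] del: upt_Suc)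
    then show ?thesis using True by (simp add: zero_ereal_def[symmetric] del: upt_Suc)
  next
    case False
    then have s: "0 < (\<Sum>n. x n)" using suminf_nonneg[OF x(2) nn] by simp
    have "(\<Sum>n. ereal (M (map x [0..<Suc n]))) / ereal (\<Sum>n. x n) \<le> hardy_const I M"
      unfolding hardy_const_def
      using x s by (intro Inf_greatest) (auto simp: ereal_divide_le_pos mult.commute simp del: upt_Suc)
    then show ?thesis using s by (simp add: ereal_divide_le_pos mult.commute del: upt_Suc)
  qed
qed

lemma homogenization_Liminf:
  assumes M: "is_mean I M" and I: "is_interval I" "bdd_below I" "Inf I = 0" "b \<in> I" "0 < b"
    and x: "x \<in> tuples {0<..}"
  shows "ereal (homogenization M x) =
           Liminf (at_right 0) (\<lambda>t. ereal (1 / t * M (map (\<lambda>a. t * a) x)))"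
    and "homogenization M x \<in> {Min (set x)..Max (set x)}"
proof -
  let ?f = "\<lambda>t. ereal (1 / t * M (map (\<lambda>a. t * a) x))"
  let ?L = "Liminf (at_right 0) ?f"
  have ne: "x \<noteq> []" and pos: "\<And>a. a \<in> set x \<Longrightarrow> 0 < a" using x by (auto simp: tuples_def)
  have inI: "c \<in> I" if c: "0 < c" "c \<le> b" for c
  proof -
    obtain a where "a \<in> I" "a < c"
      using I c cInf_lessD[of I c] by auto
    then show ?thesis using I(1) \<open>b \<in> I\<close> c unfolding is_interval_1 by (meson less_imp_le)
  qed
  have mx: "0 < Max (set x)" using ne pos Max_in[of "set x"] by auto
  have ev: "eventually (\<lambda>t. ereal (Min (set x)) \<le> ?f t \<and> ?f t \<le> ereal (Max (set x))) (at_right 0)"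
    unfolding eventually_at_right_field
  proof (intro exI[of _ "b / Max (set x)"] conjI allI impI)
    show "0 < b / Max (set x)" using mx \<open>0 < b\<close> by simp
    fix t :: real assume t: "0 < t" "t < b / Max (set x)"
    have tb: "t * Max (set x) < b" using t mx by (simp add: field_simps)
    have sub: "set (map (\<lambda>a. t * a) x) \<subseteq> I"
    proof
      fix c assume "c \<in> set (map (\<lambda>a. t * a) x)"
      then obtain a where a: "a \<in> set x" "c = t * a" by auto
      have "t * a \<le> t * Max (set x)" using a t by (intro mult_left_mono) auto
      then have "c \<le> b" using a tb by linarith
      then show "c \<in> I" using a t pos by (intro inI) auto
    qed
    have "t * Min (set x) \<le> M (map (\<lambda>a. t * a) x)" "M (map (\<lambda>a. t * a) x) \<le> t * Max (set x)"
      using ne t by (auto intro!: is_mean_bounds[OF M _ sub, of "t * Min (set x)" "t * Max (set x)"])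
    then show "ereal (Min (set x)) \<le> ?f t" "?f t \<le> ereal (Max (set x))"
      using t by (simp_all add: field_simps)
  qed
  have lo: "ereal (Min (set x)) \<le> ?L"
    by (rule Liminf_bounded) (use ev in \<open>auto elim: eventually_mono\<close>)
  have "?L \<le> Limsup (at_right 0) ?f" by (rule Liminf_le_Limsup) simp
  also have "\<dots> \<le> ereal (Max (set x))"
    by (rule Limsup_bounded) (use ev in \<open>auto elim: eventually_mono\<close>)
  finally have hi: "?L \<le> ereal (Max (set x))" .
  show eq: "ereal (homogenization M x) = ?L"
    unfolding homogenization_def using lo hi by (cases ?L) auto
  show "homogenization M x \<in> {Min (set x)..Max (set x)}"
    using lo hi unfolding eq[symmetric] by simp
qed

end

theory Submission
  imports Defs
begin

text \<open>
  The homogenization is positively homogeneous, superadditive and hence increasing, and up to a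
  small shift of the entries it dominates the mean. In \<open>M (x\<^sub>1, \<dots>, x\<^sub>k)\<close> repeat each entry
  \<open>n! / k\<close> times and index the resulting tuple by the permutations \<open>\<pi>\<close> of \<open>{1..n}\<close>, placing
  \<open>x\<^sub>j\<close> at \<open>\<pi>\<close> if \<open>\<pi> 1\<close> has rank \<open>j\<close> among \<open>\<pi> 1, \<dots>, \<pi> k\<close>. This rank is uniform on \<open>{1..k}\<close>.
  Given \<open>\<pi> 1 = i\<close>, each \<open>j \<le> i\<close> is the rank for \<open>n / i\<close> of the indices \<open>k\<close> on average,
  so summing over \<open>k\<close> and averaging over each block \<open>\<pi> 1 = i\<close> of size \<open>(n - 1)!\<close> gives the entry
  \<open>(x\<^sub>1 + \<dots> + x\<^sub>i) n / i\<close>, which is at most \<open>(x\<^sub>1 + \<dots> + x\<^sub>n) n / i\<close>.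
\<close>

section \<open>Rank paths\<close>

text \<open>
  Up to order, \<open>rank_paths m i\<close> lists, for the permutations \<open>\<pi>\<close> of \<open>{1..m + 1}\<close> with
  \<open>\<pi> 1 = i\<close>, the functions sending \<open>k\<close> to the rank of \<open>\<pi> 1\<close> among \<open>\<pi> 1, \<dots>, \<pi> k\<close>.
  The recursion inserts the relative position of the last value \<open>\<pi> (m + 2)\<close>:
  it is below \<open>\<pi> 1\<close> in \<open>i - 1\<close> ways and above it in \<open>m + 2 - i\<close> ways.
\<close>

primrec rank_paths :: "nat \<Rightarrow> nat \<Rightarrow> (nat \<Rightarrow> nat) list" where
  "rank_paths 0 i = [\<lambda>_. 1]"
| "rank_paths (Suc m) i = map (\<lambda>r. r(m + 2 := i))
     (concat (replicate (i - 1) (rank_paths m (i - 1))) @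
      concat (replicate (m + 2 - i) (rank_paths m i)))"

lemma sum_list_concat_replicate:
  fixes f :: "'a \<Rightarrow> 'b::semiring_1"
  shows "sum_list (map f (concat (replicate c xs))) = of_nat c * sum_list (map f xs)"
  by (induction c) (auto simp: algebra_simps)

lemma length_concat_replicate: "length (concat (replicate c xs)) = c * length xs"
  by (induction c) auto

lemma length_rank_paths: "i \<in> {1..Suc m} \<Longrightarrow> length (rank_paths m i) = fact m"
proof (induction m arbitrary: i)
  case (Suc m)
  \<comment> \<open>At \<open>i = 1\<close> and at \<open>i = m + 2\<close> one recursive call has
    an index outside \<open>{1..Suc m}\<close>, but its multiplicity is 0.\<close>
  have "i = 1 \<or> i - 1 \<in> {1..Suc m}" using Suc.prems by auto
  then have *: "(i - 1) * length (rank_paths m (i - 1)) = (i - 1) * fact m"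
    using Suc.IH[of "i - 1"] by auto
  have **: "(m + 2 - i) * length (rank_paths m i) = (m + 2 - i) * fact m"
    using Suc by (cases "i = m + 2") auto
  have "i - 1 + (m + 2 - i) = Suc m" using Suc.prems by auto
  moreover have "length (rank_paths (Suc m) i) = (i - 1 + (m + 2 - i)) * fact m"
    by (simp only: rank_paths.simps length_map length_append length_concat_replicate * **
        add_mult_distrib)
  ultimately show ?case by simp
qed simp

text \<open>Over the permutations of \<open>{1..m + 1}\<close> with \<open>\<pi> 1 = i\<close>, this
  totals \<open>f\<close> at the rank of \<open>\<pi> 1\<close> among the first \<open>k\<close>
  values. It serves both for indicators, giving multiplicities, and for the entries of a
  tuple.\<close>

definition path_sum :: "(nat \<Rightarrow> real) \<Rightarrow> nat \<Rightarrow> nat \<Rightarrow> nat \<Rightarrow> real" where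
  "path_sum f m i k = (\<Sum>r\<leftarrow>rank_paths m i. f (r k))"

lemma path_sum_last:
  assumes "i \<in> {1..m + 2}"
  shows "path_sum f (Suc m) i (m + 2) = fact (Suc m) * f i"
proof -
  have "path_sum f (Suc m) i (m + 2) = (\<Sum>r\<leftarrow>rank_paths (Suc m) i. f i)"
    unfolding path_sum_def by (intro arg_cong[where f = sum_list] map_cong) auto
  also have "\<dots> = fact (Suc m) * f i"
    using length_rank_paths[of i "Suc m"] assms
    by (simp add: sum_list_triv del: rank_paths.simps fact_Suc)
  finally show ?thesis .
qed

lemma path_sum_Suc:
  assumes "k \<noteq> m + 2"
  shows "path_sum f (Suc m) i k
           = real (i - 1) * path_sum f m (i - 1) k + real (m + 2 - i) * path_sum f m i k"
  using assms
  by (simp add: path_sum_def comp_def sum_list_concat_replicate[where 'b = real])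

text \<open>Uniformity of the rank, by induction on \<open>m\<close>: at \<open>k = m + 2\<close>
  the ranks are the values \<open>\<pi> 1\<close> themselves; for smaller \<open>k\<close> a new
  last value keeps the ranks and multiplies the number of permutations by
  \<open>m + 2\<close>.\<close>

lemma path_sum_row:
  assumes "k \<in> {1..Suc m}"
  shows "(\<Sum>i=1..Suc m. path_sum f m i k) = fact (Suc m) / real k * (\<Sum>j=1..k. f j)"
  using assms
proof (induction m)
  case 0
  then have "k = 1" by auto
  then show ?case by (simp add: path_sum_def)
next
  case (Suc m)
  show ?case
  proof (cases "k = m + 2")
    case True
    have "(\<Sum>i=1..Suc (Suc m). path_sum f (Suc m) i k) = (\<Sum>i=1..Suc (Suc m). fact (Suc m) * f i)"
      using True path_sum_last[of _ m f] by (intro sum.cong) auto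
    also have "\<dots> = fact (Suc m) * (\<Sum>i=1..k. f i)" unfolding True sum_distrib_left by simp
    also have "fact (Suc m) = (fact (Suc (Suc m)) / real k :: real)"
      unfolding fact_Suc[of "Suc m"] using True by (simp add: field_simps del: fact_Suc)
    finally show ?thesis .
  next
    case False
    let ?T = "\<lambda>i. path_sum f m i k"
    have "(\<Sum>i=1..Suc (Suc m). path_sum f (Suc m) i k)
        = (\<Sum>i=1..Suc (Suc m). real (i - 1) * ?T (i - 1)) + (\<Sum>i=1..Suc (Suc m). real (m + 2 - i) * ?T i)"
      using False by (simp add: path_sum_Suc sum.distrib)
    also have "(\<Sum>i=1..Suc (Suc m). real (i - 1) * ?T (i - 1)) = (\<Sum>i=0..Suc m. real i * ?T i)"
      using sum.shift_bounds_cl_Suc_ivl[of "\<lambda>i. real (i - 1) * ?T (i - 1)" 0 "Suc m"] by simp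
    also have "\<dots> = (\<Sum>i=1..Suc m. real i * ?T i)"
      by (simp add: sum.atLeast_Suc_atMost)
    also have "(\<Sum>i=1..Suc (Suc m). real (m + 2 - i) * ?T i) = (\<Sum>i=1..Suc m. real (m + 2 - i) * ?T i)"
      by simp
    \<comment> \<open>Row \<open>i\<close> of level \<open>m\<close> is used \<open>i\<close> times
      by row \<open>i + 1\<close> and \<open>m + 2 - i\<close> times by row \<open>i\<close>, hence
      \<open>m + 2\<close> times in all.\<close>
    also have "(\<Sum>i=1..Suc m. real i * ?T i) + (\<Sum>i=1..Suc m. real (m + 2 - i) * ?T i)
        = (\<Sum>i=1..Suc m. real (Suc (Suc m)) * ?T i)"
      unfolding sum.distrib[symmetric]
      by (intro sum.cong) (auto simp: of_nat_diff algebra_simps)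
    also have "\<dots> = real (Suc (Suc m)) * (\<Sum>i=1..Suc m. ?T i)" by (rule sum_distrib_left[symmetric])
    also have "\<dots> = real (Suc (Suc m)) * (fact (Suc m) / real k * (\<Sum>j=1..k. f j))"
      using Suc False by simp
    also have "\<dots> = fact (Suc (Suc m)) / real k * (\<Sum>j=1..k. f j)"
      unfolding fact_Suc[of "Suc m"] by (simp add: del: fact_Suc)
    finally show ?thesis .
  qed
qed

text \<open>Induction on \<open>m\<close>: with \<open>c = fact (Suc m)\<close>, row
  \<open>i - 1\<close> and the new last index together give each \<open>f j\<close>,
  \<open>j \<le> i\<close>, the weight \<open>c\<close>; row \<open>i\<close> adds
  \<open>(m + 2 - i) * c / i\<close>, for a total of \<open>(m + 2) * c / i\<close>.\<close>

lemma path_sum_column: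
  assumes "i \<in> {1..Suc m}"
  shows "(\<Sum>k=1..Suc m. path_sum f m i k) = fact (Suc m) / real i * (\<Sum>j=1..i. f j)"
  using assms
proof (induction m arbitrary: i)
  case 0
  then have "i = 1" by auto
  then show ?case by (simp add: path_sum_def)
next
  case (Suc m)
  let ?c = "fact (Suc m) :: real"
  let ?S = "\<lambda>i. \<Sum>k=1..Suc m. path_sum f m i k"
  have i: "0 < real i" using Suc.prems by simp
  have "i = 1 \<or> i - 1 \<in> {1..Suc m}" using Suc.prems by auto
  then have below: "real (i - 1) * ?S (i - 1) = ?c * (\<Sum>j=1..i-1. f j)"
    using Suc.IH[of "i - 1"] by (elim disjE) (simp_all del: fact_Suc sum.cl_ivl_Suc)
  have above: "real (m + 2 - i) * ?S i = (real m + 2 - real i) * (?c / real i * (\<Sum>j=1..i. f j))"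
    using Suc.IH[of i] Suc.prems by (cases "i = m + 2") (auto simp: of_nat_diff simp del: fact_Suc sum.cl_ivl_Suc)
  have split: "(\<Sum>j=1..i. f j) = (\<Sum>j=1..i-1. f j) + f i"
    using Suc.prems by (cases i) auto
  have "(\<Sum>k=1..Suc (Suc m). path_sum f (Suc m) i k)
      = (\<Sum>k=1..Suc m. path_sum f (Suc m) i k) + path_sum f (Suc m) i (m + 2)" by simp
  also have "(\<Sum>k=1..Suc m. path_sum f (Suc m) i k) = (\<Sum>k=1..Suc m.
      real (i - 1) * path_sum f m (i - 1) k + real (m + 2 - i) * path_sum f m i k)"
    by (intro sum.cong path_sum_Suc) auto
  also have "\<dots> = real (i - 1) * ?S (i - 1) + real (m + 2 - i) * ?S i"
    unfolding sum.distrib sum_distrib_left ..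
  also have "path_sum f (Suc m) i (m + 2) = ?c * f i"
    using Suc.prems by (intro path_sum_last) auto
  also have "real (i - 1) * ?S (i - 1) + real (m + 2 - i) * ?S i + ?c * f i
      = ?c * (\<Sum>j=1..i. f j) + (real m + 2 - real i) * (?c / real i * (\<Sum>j=1..i. f j))"
    unfolding below above split by (simp add: algebra_simps)
  also have "\<dots> = (real (Suc (Suc m)) * ?c) / real i * (\<Sum>j=1..i. f j)"
    using i by (simp add: field_simps)
  also have "real (Suc (Suc m)) * ?c = fact (Suc (Suc m))" by simp
  finally show ?case .
qed

lemma rank_paths_range:
  "i \<in> {1..Suc m} \<Longrightarrow> r \<in> set (rank_paths m i) \<Longrightarrow> k \<in> {1..Suc m} \<Longrightarrow> r k \<in> {1..k}"
proof (induction m arbitrary: i r)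
  case (Suc m)
  from Suc.prems(2) obtain r' where r: "r = r'(m + 2 := i)"
    and "i \<noteq> 1 \<and> r' \<in> set (rank_paths m (i - 1)) \<or> i \<noteq> m + 2 \<and> r' \<in> set (rank_paths m i)"
    by (auto split: if_splits simp: set_replicate_conv_if)
  then have "\<exists>i'. r' \<in> set (rank_paths m i') \<and> i' \<in> {1..Suc m}"
    using Suc.prems(1) by (elim disjE) (rule exI[of _ "i - 1"], force, rule exI[of _ i], force)
  then obtain i' where r': "r' \<in> set (rank_paths m i')" "i' \<in> {1..Suc m}" by blast
  then show ?case
    using Suc.IH[OF r'(2,1)] Suc.prems r by (cases "k = m + 2") auto
qed auto

section \<open>Tuples indexed by permutations and averaging over blocks\<close>

lemma count_mset_sum_list: "real (count (mset xs) a) = (\<Sum>x\<leftarrow>xs. of_bool (x = a))"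
  by (induction xs) auto

lemma map_nth_rotate:
  "map (\<lambda>q. xs ! ((q + s) mod length xs)) [0..<length xs] = rotate s xs"
  by (rule nth_equalityI) (auto simp: nth_rotate add.commute)

lemma sum_list_map_rotate:
  fixes f :: "'a \<Rightarrow> 'b::comm_monoid_add"
  shows "(\<Sum>x\<leftarrow>rotate q xs. f x) = (\<Sum>x\<leftarrow>xs. f x)"
proof -
  have "(\<Sum>x\<leftarrow>rotate1 ys. f x) = (\<Sum>x\<leftarrow>ys. f x)" for ys
    by (cases ys) (auto simp: add.commute)
  then show ?thesis by (induction q) auto
qed

lemma sum_list_concat_map_replicate:
  fixes f :: "'a \<Rightarrow> real"
  shows "(\<Sum>y\<leftarrow>concat (map (replicate c) ys). f y) = real c * (\<Sum>y\<leftarrow>ys. f y)"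
  by (induction ys) (auto simp: sum_list_replicate algebra_simps)

lemma sum_list_concat: "sum_list (concat xss) = sum_list (map sum_list xss)"
  by (induction xss) auto

text \<open>Over a full period of shifts, a fixed position meets every entry once; this turns a sum
  over shifts into a block average.\<close>

lemma sum_rotate:
  fixes f :: "'a \<Rightarrow> 'b::comm_monoid_add"
  shows "(\<Sum>s<length xs. f (xs ! ((q + s) mod length xs))) = (\<Sum>x\<leftarrow>xs. f x)"
proof -
  have "(\<Sum>s<length xs. f (xs ! ((q + s) mod length xs)))
      = sum_list (map f (map (\<lambda>s. xs ! ((s + q) mod length xs)) [0..<length xs]))"
    by (simp add: comp_def interv_sum_list_conv_sum_set_nat atLeast0LessThan add.commute)
  also have "\<dots> = sum_list (map f (rotate q xs))" by (simp only: map_nth_rotate)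
  also have "\<dots> = (\<Sum>x\<leftarrow>xs. f x)" by (rule sum_list_map_rotate)
  finally show ?thesis .
qed

text \<open>The pair \<open>(i, q)\<close> stands for the \<open>q\<close>-th permutation with
  \<open>\<pi> 1 = i\<close>. The blocks are ordered as in \<open>repeated_mean\<close>.\<close>

definition block_positions :: "nat \<Rightarrow> (nat \<times> nat) list" where
  "block_positions m = concat (map (\<lambda>i. map (Pair i) [0..<fact m]) [1..<Suc (Suc m)])"

text \<open>
  The shift \<open>s\<close> rotates the positions within each block; summing over all shifts is the
  averaging over blocks.
\<close>

definition rank_at :: "nat \<Rightarrow> nat \<Rightarrow> nat \<Rightarrow> nat \<times> nat \<Rightarrow> nat" where
  "rank_at m k s p = (rank_paths m (fst p) ! ((snd p + s) mod fact m)) k"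

lemma set_block_positions: "set (block_positions m) = {1..Suc m} \<times> {..<fact m}"
  by (auto simp: block_positions_def image_iff)

lemma block_positions_nonempty: "block_positions m \<noteq> []"
proof -
  have "(1, 0) \<in> set (block_positions m)" by (simp add: set_block_positions)
  then show ?thesis by auto
qed

lemma map_block_positions_const:
  "map (\<lambda>p. f (fst p)) (block_positions m)
     = concat (map (\<lambda>i. replicate (fact m) (f i)) [1..<Suc (Suc m)])"
  by (simp add: block_positions_def map_concat comp_def map_replicate_const del: upt_Suc)

lemma rank_at_range:
  assumes "p \<in> set (block_positions m)" "k \<in> {1..Suc m}"
  shows "rank_at m k s p \<in> {1..k}"
  unfolding rank_at_def
proof (rule rank_paths_range)
  show "fst p \<in> {1..Suc m}" using assms by (auto simp: set_block_positions)
  then show "rank_paths m (fst p) ! ((snd p + s) mod fact m) \<in> set (rank_paths m (fst p))"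
    by (intro nth_mem) (simp add: length_rank_paths)
qed fact

lemma map_rank_at_block_positions:
  "map (\<lambda>p. f (rank_at m k s p)) (block_positions m)
     = concat (map (\<lambda>i. map (\<lambda>r. f (r k)) (rotate s (rank_paths m i))) [1..<Suc (Suc m)])"
proof -
  have "map (\<lambda>q. f (rank_at m k s (i, q))) [0..<fact m] = map (\<lambda>r. f (r k)) (rotate s (rank_paths m i))"
    if "i \<in> set [1..<Suc (Suc m)]" for i
  proof -
    have "length (rank_paths m i) = fact m" using that by (intro length_rank_paths) auto
    then show ?thesis
      using map_nth_rotate[of "rank_paths m i" s, symmetric] by (simp add: rank_at_def comp_def)
  qed
  then have "map (\<lambda>i. map (\<lambda>q. f (rank_at m k s (i, q))) [0..<fact m]) [1..<Suc (Suc m)]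
      = map (\<lambda>i. map (\<lambda>r. f (r k)) (rotate s (rank_paths m i))) [1..<Suc (Suc m)]"
    by (intro map_cong refl)
  moreover have "map (\<lambda>p. f (rank_at m k s p)) (block_positions m)
      = concat (map (\<lambda>i. map (\<lambda>q. f (rank_at m k s (i, q))) [0..<fact m]) [1..<Suc (Suc m)])"
    by (simp add: block_positions_def map_concat comp_def del: upt_Suc)
  ultimately show ?thesis by (simp only:)
qed

text \<open>Rotations keep the multiset of each block, and by \<open>path_sum_row\<close> every rank
  occurs equally often. Symmetry of the mean can then replace the repeated tuple by the one indexed
  by permutations.\<close>

lemma mset_rank_at:
  assumes k: "k \<in> {1..Suc m}" "k \<le> length x"
  shows "mset (map (\<lambda>p. x ! (rank_at m k s p - 1)) (block_positions m))
           = mset (concat (map (replicate (fact (Suc m) div k)) (take k x)))"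
proof (rule multiset_eqI)
  fix a
  \<comment> \<open>Applied to the indicator of the value \<open>a\<close>,
    \<open>path_sum_row\<close> counts multiplicities.\<close>
  let ?f = "\<lambda>j. of_bool (x ! (j - 1) = a) :: real"
  have take: "(\<Sum>y\<leftarrow>take k x. g y) = (\<Sum>j<k. g (x ! j))" for g :: "'a \<Rightarrow> real"
    using k(2) by (simp add: sum_list_sum_nth atLeast0LessThan min_def)
  have dvd: "k dvd fact (Suc m)" using k by (intro dvd_fact) auto
  have "real (count (mset (map (\<lambda>p. x ! (rank_at m k s p - 1)) (block_positions m))) a)
      = (\<Sum>p\<leftarrow>block_positions m. ?f (rank_at m k s p))"
    unfolding count_mset_sum_list by (simp add: comp_def)
  also have "\<dots> = (\<Sum>i\<leftarrow>[1..<Suc (Suc m)]. \<Sum>r\<leftarrow>rotate s (rank_paths m i). ?f (r k))"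
    by (simp only: map_rank_at_block_positions[of ?f m k s] sum_list_concat map_map comp_def)
  also have "\<dots> = (\<Sum>i\<leftarrow>[1..<Suc (Suc m)]. path_sum ?f m i k)"
    by (simp only: path_sum_def sum_list_map_rotate)
  also have "\<dots> = (\<Sum>i=1..Suc m. path_sum ?f m i k)"
    by (simp add: interv_sum_list_conv_sum_set_nat atLeastLessThanSuc_atLeastAtMost del: upt_Suc)
  also have "\<dots> = fact (Suc m) / real k * (\<Sum>j=1..k. ?f j)" using k by (intro path_sum_row)
  also have "(\<Sum>j=1..k. ?f j) = (\<Sum>j<k. ?f (Suc j))"
    by (simp only: One_nat_def sum.atLeast1_atMost_eq)
  also have "\<dots> = (\<Sum>y\<leftarrow>take k x. of_bool (y = a))"
    using take[of "\<lambda>y. of_bool (y = a)"] by (simp only: diff_Suc_1)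
  also have "fact (Suc m) / real k = real (fact (Suc m) div k)"
    using dvd by (simp add: real_of_nat_div del: fact_Suc)
  also have "real (fact (Suc m) div k) * (\<Sum>y\<leftarrow>take k x. of_bool (y = a))
      = real (count (mset (concat (map (replicate (fact (Suc m) div k)) (take k x)))) a)"
    by (simp only: count_mset_sum_list sum_list_concat_map_replicate)
  finally show "count (mset (map (\<lambda>p. x ! (rank_at m k s p - 1)) (block_positions m))) a
      = count (mset (concat (map (replicate (fact (Suc m) div k)) (take k x)))) a"
    by simp
qed

text \<open>The sum over \<open>s\<close> visits the whole block, so the result depends only on
  \<open>fst p\<close>; the sum over \<open>k\<close> is then
  \<open>path_sum_column\<close>.\<close>

lemma sum_rank_at:
  assumes "p \<in> set (block_positions m)"
  shows "(\<Sum>(k, s)\<in>{1..Suc m} \<times> {..<fact m}. f (rank_at m k s p))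
           = fact (Suc m) / real (fst p) * (\<Sum>j=1..fst p. f j)"
proof -
  have i: "fst p \<in> {1..Suc m}" using assms by (auto simp: set_block_positions)
  have "(\<Sum>(k, s)\<in>{1..Suc m} \<times> {..<fact m}. f (rank_at m k s p))
      = (\<Sum>k=1..Suc m. \<Sum>s<fact m. f (rank_at m k s p))"
    by (rule sum.cartesian_product[symmetric])
  also have "\<dots> = (\<Sum>k=1..Suc m. path_sum f m (fst p) k)"
    using sum_rotate[of "\<lambda>r. f (r _)" "rank_paths m (fst p)" "snd p"] length_rank_paths[OF i]
    by (simp add: rank_at_def path_sum_def)
  also have "\<dots> = fact (Suc m) / real (fst p) * (\<Sum>j=1..fst p. f j)"
    using i by (rule path_sum_column)
  finally show ?thesis .
qed

section \<open>Jensen concave means near zero\<close>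

text \<open>Once \<open>2 ^ j * (b - a) > 1\<close>, the first multiple of \<open>1 / 2 ^ j\<close>
  above \<open>a\<close> is still below \<open>b\<close>.\<close>

lemma dyadic_between:
  fixes a b :: real
  assumes "0 \<le> a" "a < b"
  obtains j m :: nat where "a < real m / 2 ^ j" "real m / 2 ^ j < b"
proof -
  obtain j :: nat where j: "1 / (b - a) < 2 ^ j"
    using real_arch_pow[of 2 "1 / (b - a)"] by auto
  define m where "m = nat (\<lfloor>a * 2 ^ j\<rfloor> + 1)"
  have m: "real m = of_int \<lfloor>a * 2 ^ j\<rfloor> + 1" using assms by (simp add: m_def)
  have "a * 2 ^ j < real m" "real m \<le> a * 2 ^ j + 1" unfolding m by linarith+
  moreover have "a * 2 ^ j + 1 < b * 2 ^ j" using j assms by (simp add: field_simps)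
  ultimately show ?thesis using that[of m j] by (simp add: field_simps)
qed

lemma eventually_at_right_scale:
  fixes s :: real
  assumes "0 < s" "eventually P (at_right 0)"
  shows "eventually (\<lambda>t. P (s * t)) (at_right 0)"
proof -
  obtain b where "0 < b" "\<And>y. 0 < y \<Longrightarrow> y < b \<Longrightarrow> P y"
    using assms(2) by (auto simp: eventually_at_right_field)
  then show ?thesis using assms(1)
    by (auto simp: eventually_at_right_field field_simps intro!: exI[of _ "b / s"])
qed

text \<open>The point \<open>b\<close> witnesses that \<open>I\<close> contains all of
  \<open>(0, b]\<close>, whether or not 0 lies in \<open>I\<close>.\<close>

locale jensen_concave_mean_at_0 =
  fixes I :: "real set" and M :: "real list \<Rightarrow> real" and b :: real
  assumes interval: "is_interval I" "bdd_below I" "Inf I = 0" "b \<in> I" "0 < b"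
    and mean: "is_mean I M"
    and concave: "jensen_concave_mean I M"
begin

lemma interval_nonneg: "I \<subseteq> {0..}"
  using cInf_lower[OF _ interval(2)] interval(3) by auto

lemma interval_mem:
  assumes "0 < c" "c \<le> b"
  shows "c \<in> I"
proof -
  obtain a where "a \<in> I" "a < c"
    using interval(3,4) assms(1) cInf_lessD[of I c] by auto
  then show ?thesis
    using interval(1,4) assms(2) unfolding is_interval_1 by (meson less_imp_le)
qed

lemma mean_nonneg:
  assumes "x \<in> tuples I"
  shows "0 \<le> M x"
proof -
  have "M x \<in> I" using mean assms unfolding is_mean_def by blast
  then show ?thesis using interval_nonneg by auto
qed

text \<open>Tuples are maps over one common index list, so equal lengths are automatic and
  combinations are formed pointwise.\<close>

lemma midpoint_concave:
  assumes "xs \<noteq> []" "\<And>z. z \<in> set xs \<Longrightarrow> f z \<in> I" "\<And>z. z \<in> set xs \<Longrightarrow> g z \<in> I"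
  shows "(M (map f xs) + M (map g xs)) / 2 \<le> M (map (\<lambda>z. (f z + g z) / 2) xs)"
proof -
  have "map f xs \<in> tuples I" "map g xs \<in> tuples I"
    using assms by (auto simp: tuples_def)
  then have "(M (map f xs) + M (map g xs)) / 2
      \<le> M (map2 (\<lambda>a b. (a + b) / 2) (map f xs) (map g xs))"
    using concave unfolding jensen_concave_mean_def by (auto dest!: bspec)
  also have "map2 (\<lambda>a b. (a + b) / 2) (map f xs) (map g xs) = map (\<lambda>z. (f z + g z) / 2) xs"
    by (induction xs) auto
  finally show ?thesis .
qed

lemma segment_mem:
  assumes "u \<in> I" "v \<in> I" "0 \<le> q" "q \<le> 1"
  shows "q * u + (1 - q) * v \<in> I"
  using is_interval_convex[OF interval(1)] assms convexD[of I u v q "1 - q"] by simp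

text \<open>Induction on \<open>j\<close> by halving: the combination with weight
  \<open>m / 2 ^ Suc j\<close> is the midpoint of a level-\<open>j\<close> combination and of
  \<open>g\<close> if \<open>m \<le> 2 ^ j\<close>, of \<open>f\<close> otherwise.\<close>

lemma dyadic_concave:
  assumes "xs \<noteq> []" "\<And>z. z \<in> set xs \<Longrightarrow> f z \<in> I" "\<And>z. z \<in> set xs \<Longrightarrow> g z \<in> I"
    and "m \<le> 2 ^ j"
  shows "real m / 2 ^ j * M (map f xs) + (1 - real m / 2 ^ j) * M (map g xs)
           \<le> M (map (\<lambda>z. real m / 2 ^ j * f z + (1 - real m / 2 ^ j) * g z) xs)"
  using assms(4)
proof (induction j arbitrary: m)
  case 0
  then have "m = 0 \<or> m = 1" by auto
  then show ?case by auto
next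
  case (Suc j)
  show ?case
  proof (cases "m \<le> 2 ^ j")
    case True
    let ?q = "real m / 2 ^ j"
    let ?w = "\<lambda>z. ?q * f z + (1 - ?q) * g z"
    have q: "0 \<le> ?q" "?q \<le> 1" "real m / 2 ^ Suc j = ?q / 2" using True by (simp_all add: divide_simps)
    have "?q / 2 * M (map f xs) + (1 - ?q / 2) * M (map g xs)
        = (?q * M (map f xs) + (1 - ?q) * M (map g xs) + M (map g xs)) / 2"
      by (simp add: algebra_simps add_divide_distrib diff_divide_distrib)
    also have "\<dots> \<le> (M (map ?w xs) + M (map g xs)) / 2"
      by (rule divide_right_mono[OF add_right_mono[OF Suc.IH[OF True]]]) simp
    also have "(M (map ?w xs) + M (map g xs)) / 2 \<le> M (map (\<lambda>z. (?w z + g z) / 2) xs)"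
      using assms q by (intro midpoint_concave segment_mem) auto
    also have "(\<lambda>z. (?w z + g z) / 2) = (\<lambda>z. ?q / 2 * f z + (1 - ?q / 2) * g z)"
      by (simp add: fun_eq_iff algebra_simps add_divide_distrib diff_divide_distrib)
    finally show ?thesis unfolding q(3) .
  next
    case False
    define l where "l = m - 2 ^ j"
    have l: "l \<le> 2 ^ j" using Suc.prems by (simp add: l_def)
    let ?q = "real l / 2 ^ j"
    let ?w = "\<lambda>z. ?q * f z + (1 - ?q) * g z"
    have m: "real m = real l + 2 ^ j" using False by (simp add: l_def of_nat_diff)
    have q: "0 \<le> ?q" "?q \<le> 1" "real m / 2 ^ Suc j = (1 + ?q) / 2"
      unfolding m using l by (simp_all add: field_simps)
    have "(1 + ?q) / 2 * M (map f xs) + (1 - (1 + ?q) / 2) * M (map g xs)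
        = (M (map f xs) + (?q * M (map f xs) + (1 - ?q) * M (map g xs))) / 2"
      by (simp add: algebra_simps add_divide_distrib diff_divide_distrib)
    also have "\<dots> \<le> (M (map f xs) + M (map ?w xs)) / 2"
      by (rule divide_right_mono[OF add_left_mono[OF Suc.IH[OF l]]]) simp
    also have "(M (map f xs) + M (map ?w xs)) / 2 \<le> M (map (\<lambda>z. (f z + ?w z) / 2) xs)"
      using assms q by (intro midpoint_concave segment_mem) auto
    also have "(\<lambda>z. (f z + ?w z) / 2) = (\<lambda>z. (1 + ?q) / 2 * f z + (1 - (1 + ?q) / 2) * g z)"
      by (simp add: fun_eq_iff algebra_simps add_divide_distrib diff_divide_distrib)
    finally show ?thesis unfolding q(3) .
  qed
qed

section \<open>Properties of the homogenization\<close>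

abbreviation hom :: "real list \<Rightarrow> real" where "hom \<equiv> homogenization M"

lemma eventually_scaled_mem:
  assumes "\<And>z. z \<in> set xs \<Longrightarrow> 0 < f z"
  shows "eventually (\<lambda>t. \<forall>z\<in>set xs. t * f z \<in> I) (at_right 0)"
proof (rule eventually_ball_finite)
  show "\<forall>z\<in>set xs. eventually (\<lambda>t. t * f z \<in> I) (at_right 0)"
  proof
    fix z assume "z \<in> set xs"
    then have "0 < f z" by (rule assms)
    then show "eventually (\<lambda>t. t * f z \<in> I) (at_right 0)"
      unfolding eventually_at_right_field using interval(5)
      by (intro exI[of _ "b / f z"]) (auto simp: field_simps intro!: interval_mem)
  qed
qed simp

text \<open>With \<open>le_homI\<close>, this trades the lower limit for linear bounds on the mean
  at small \<open>t\<close>.\<close>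

lemma eventually_less_if_less_hom:
  assumes "xs \<noteq> []" "\<And>z. z \<in> set xs \<Longrightarrow> 0 < f z" "c < hom (map f xs)"
  shows "eventually (\<lambda>t. c * t < M (map (\<lambda>z. t * f z) xs)) (at_right 0)"
proof -
  have "ereal (hom (map f xs))
      = Liminf (at_right 0) (\<lambda>t. ereal (1 / t * M (map (\<lambda>a. t * a) (map f xs))))"
    using assms by (intro homogenization_Liminf[OF mean interval]) (auto simp: tuples_def)
  then have "eventually (\<lambda>t. ereal c < ereal (1 / t * M (map (\<lambda>a. t * a) (map f xs)))) (at_right 0)"
    using assms(3) by (intro less_LiminfD) (metis ereal_less_eq(3) linorder_not_le)
  moreover have "eventually (\<lambda>t::real. 0 < t) (at_right 0)" by (rule eventually_at_right_less)
  ultimately show ?thesis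
    by eventually_elim (simp add: comp_def field_simps)
qed

lemma le_homI:
  assumes "xs \<noteq> []" "\<And>z. z \<in> set xs \<Longrightarrow> 0 < f z"
    and "eventually (\<lambda>t. c * t \<le> M (map (\<lambda>z. t * f z) xs)) (at_right 0)"
  shows "c \<le> hom (map f xs)"
proof -
  have eq: "ereal (hom (map f xs))
      = Liminf (at_right 0) (\<lambda>t. ereal (1 / t * M (map (\<lambda>a. t * a) (map f xs))))"
    using assms by (intro homogenization_Liminf[OF mean interval]) (auto simp: tuples_def)
  have "eventually (\<lambda>t::real. 0 < t) (at_right 0)" by (rule eventually_at_right_less)
  with assms(3) have "eventually (\<lambda>t. ereal c \<le> ereal (1 / t * M (map (\<lambda>a. t * a) (map f xs)))) (at_right 0)"
    by eventually_elim (simp add: comp_def field_simps)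
  then have "ereal c \<le> ereal (hom (map f xs))" unfolding eq by (rule Liminf_bounded)
  then show ?thesis by simp
qed

lemma hom_nonneg:
  assumes "xs \<noteq> []" "\<And>z. z \<in> set xs \<Longrightarrow> 0 < f z"
  shows "0 \<le> hom (map f xs)"
proof (rule le_homI[OF assms])
  have "eventually (\<lambda>t. \<forall>z\<in>set xs. t * f z \<in> I) (at_right 0)"
    using assms(2) by (rule eventually_scaled_mem)
  then show "eventually (\<lambda>t. 0 * t \<le> M (map (\<lambda>z. t * f z) xs)) (at_right 0)"
    by eventually_elim (use assms(1) in \<open>auto simp: tuples_def intro!: mean_nonneg\<close>)
qed

text \<open>Substitute \<open>s * t\<close> for \<open>t\<close> in the lower limit.\<close>

lemma hom_scale_ge:
  assumes "xs \<noteq> []" "\<And>z. z \<in> set xs \<Longrightarrow> 0 < f z" "0 < s"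
  shows "s * hom (map f xs) \<le> hom (map (\<lambda>z. s * f z) xs)"
proof -
  have "c \<le> hom (map (\<lambda>z. s * f z) xs) / s" if c: "c < hom (map f xs)" for c
  proof -
    have "eventually (\<lambda>t. c * (s * t) < M (map (\<lambda>z. s * t * f z) xs)) (at_right 0)"
      using eventually_at_right_scale[OF assms(3) eventually_less_if_less_hom[OF assms(1,2) c]] .
    then have "c * s \<le> hom (map (\<lambda>z. s * f z) xs)"
      using assms by (intro le_homI) (auto elim!: eventually_mono simp: mult_ac)
    then show ?thesis using assms(3) by (simp add: field_simps)
  qed
  then have "hom (map f xs) \<le> hom (map (\<lambda>z. s * f z) xs) / s" by (rule dense_le)
  then show ?thesis using assms(3) by (simp add: field_simps)
qed

lemma hom_scale:
  assumes "xs \<noteq> []" "\<And>z. z \<in> set xs \<Longrightarrow> 0 < f z" "0 < s"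
  shows "hom (map (\<lambda>z. s * f z) xs) = s * hom (map f xs)"
proof (rule antisym)
  \<comment> \<open>The reverse inequality is \<open>hom_scale_ge\<close> with factor
    \<open>1 / s\<close> at the scaled tuple.\<close>
  have "1 / s * hom (map (\<lambda>z. s * f z) xs) \<le> hom (map (\<lambda>z. 1 / s * (s * f z)) xs)"
    using assms by (intro hom_scale_ge) auto
  then show "hom (map (\<lambda>z. s * f z) xs) \<le> s * hom (map f xs)"
    using assms(3) by (simp add: field_simps)
qed (rule hom_scale_ge[OF assms])

text \<open>The tuple \<open>t * (f + g)\<close> is the midpoint of \<open>2 * t * f\<close> and
  \<open>2 * t * g\<close>, so midpoint concavity adds the two linear lower bounds.\<close>

lemma hom_superadditive:
  assumes "xs \<noteq> []" "\<And>z. z \<in> set xs \<Longrightarrow> 0 < f z" "\<And>z. z \<in> set xs \<Longrightarrow> 0 < g z"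
  shows "hom (map f xs) + hom (map g xs) \<le> hom (map (\<lambda>z. f z + g z) xs)"
proof -
  let ?h = "hom (map (\<lambda>z. f z + g z) xs)"
  have "c + d \<le> ?h" if c: "c < hom (map f xs)" and d: "d < hom (map g xs)" for c d
  proof (rule le_homI)
    have two: "(0::real) < 2" by simp
    have "eventually (\<lambda>t. c * (2 * t) < M (map (\<lambda>z. 2 * t * f z) xs)) (at_right 0)"
      "eventually (\<lambda>t. d * (2 * t) < M (map (\<lambda>z. 2 * t * g z) xs)) (at_right 0)"
      "eventually (\<lambda>t. \<forall>z\<in>set xs. 2 * t * f z \<in> I) (at_right 0)"
      "eventually (\<lambda>t. \<forall>z\<in>set xs. 2 * t * g z \<in> I) (at_right 0)"
      using assms c d
      by (intro eventually_at_right_scale[OF two eventually_less_if_less_hom]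
          eventually_at_right_scale[OF two eventually_scaled_mem]; simp)+
    then show "eventually (\<lambda>t. (c + d) * t \<le> M (map (\<lambda>z. t * (f z + g z)) xs)) (at_right 0)"
    proof eventually_elim
      case (elim t)
      have "(M (map (\<lambda>z. 2 * t * f z) xs) + M (map (\<lambda>z. 2 * t * g z) xs)) / 2
          \<le> M (map (\<lambda>z. (2 * t * f z + 2 * t * g z) / 2) xs)"
        using elim assms(1) by (intro midpoint_concave) auto
      also have "(\<lambda>z. (2 * t * f z + 2 * t * g z) / 2) = (\<lambda>z. t * (f z + g z))"
        by (simp add: fun_eq_iff algebra_simps add_divide_distrib)
      finally show ?case using elim(1,2) by (simp add: algebra_simps)
    qed
  qed (use assms in \<open>auto intro: add_pos_pos\<close>)
  \<comment> \<open>First \<open>d\<close> and then \<open>c\<close> increases to its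
    homogenization.\<close>
  then have "c \<le> ?h - hom (map g xs)" if "c < hom (map f xs)" for c
    using that dense_le[of "hom (map g xs)" "?h - c"] by (smt (verit))
  then have "hom (map f xs) \<le> ?h - hom (map g xs)" by (rule dense_le)
  then show ?thesis by simp
qed

lemma hom_sum_ge:
  assumes "finite A" "A \<noteq> {}" "xs \<noteq> []" "\<And>a z. a \<in> A \<Longrightarrow> z \<in> set xs \<Longrightarrow> 0 < v a z"
  shows "(\<Sum>a\<in>A. hom (map (v a) xs)) \<le> hom (map (\<lambda>z. \<Sum>a\<in>A. v a z) xs)"
  using assms(1,2,4)
proof (induction A rule: finite_ne_induct)
  case (insert a A)
  have "(\<Sum>a\<in>insert a A. hom (map (v a) xs))
      \<le> hom (map (v a) xs) + hom (map (\<lambda>z. \<Sum>a\<in>A. v a z) xs)"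
    using insert by simp
  also have "\<dots> \<le> hom (map (\<lambda>z. v a z + (\<Sum>a\<in>A. v a z)) xs)"
    using insert assms(3) by (intro hom_superadditive) (auto intro!: sum_pos)
  finally show ?case using insert by simp
qed simp

text \<open>Superadditivity with the increment \<open>g - f\<close>; strictness keeps this increment
  a positive tuple.\<close>

lemma hom_mono:
  assumes "xs \<noteq> []" "\<And>z. z \<in> set xs \<Longrightarrow> 0 < f z" "\<And>z. z \<in> set xs \<Longrightarrow> f z < g z"
  shows "hom (map f xs) \<le> hom (map g xs)"
proof -
  have "hom (map f xs) + 0 \<le> hom (map f xs) + hom (map (\<lambda>z. g z - f z) xs)"
    using assms by (intro add_left_mono hom_nonneg) auto
  also have "\<dots> \<le> hom (map (\<lambda>z. f z + (g z - f z)) xs)"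
    using assms by (intro hom_superadditive) auto
  finally show ?thesis by simp
qed

text \<open>
  For a dyadic \<open>q\<close> slightly below \<open>t\<close>, the point \<open>t * (f z + \<eta>)\<close> lies between \<open>f z\<close>, with
  weight \<open>q\<close>, and another point of \<open>I\<close> close to 0, where the mean is nonnegative. The shift by
  \<open>\<eta>\<close> also takes care of the entries that are equal to 0.
\<close>

lemma mean_le_hom_shift:
  assumes "xs \<noteq> []" "\<And>z. z \<in> set xs \<Longrightarrow> f z \<in> I" "0 < \<eta>"
  shows "M (map f xs) \<le> hom (map (\<lambda>z. f z + \<eta>) xs)"
proof -
  let ?m = "M (map f xs)"
  have f0: "0 \<le> f z" if "z \<in> set xs" for z using assms(2)[OF that] interval_nonneg by auto
  have pos: "0 < f z + \<eta>" if "z \<in> set xs" for z using f0[OF that] assms(3) by simp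
  have m0: "0 \<le> ?m" using assms by (intro mean_nonneg) (auto simp: tuples_def)
  have main: "c \<le> hom (map (\<lambda>z. f z + \<eta>) xs)" if c: "0 \<le> c" "c < ?m" for c
  proof (rule le_homI[OF assms(1) pos])
    \<comment> \<open>The factor 2 pays for the division by \<open>1 - q > 1 / 2\<close> in
      \<open>g\<close> below.\<close>
    have ev: "eventually (\<lambda>t. \<forall>z\<in>set xs. 2 * t * (f z + \<eta>) < b) (at_right 0)"
    proof (rule eventually_ball_finite)
      show "\<forall>z\<in>set xs. eventually (\<lambda>t. 2 * t * (f z + \<eta>) < b) (at_right 0)"
      proof
        fix z assume "z \<in> set xs"
        then have "0 < f z + \<eta>" by (rule pos)
        then show "eventually (\<lambda>t. 2 * t * (f z + \<eta>) < b) (at_right 0)"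
          unfolding eventually_at_right_field using interval(5)
          by (intro exI[of _ "b / (2 * (f z + \<eta>))"]) (auto simp: field_simps)
      qed
    qed simp
    have "eventually (\<lambda>t::real. 0 < t \<and> t < 1 / 2) (at_right 0)"
      unfolding eventually_at_right_field by (intro exI[of _ "1 / 2"]) auto
    with ev show "eventually (\<lambda>t. c * t \<le> M (map (\<lambda>z. t * (f z + \<eta>)) xs)) (at_right 0)"
    proof eventually_elim
      case (elim t)
      \<comment> \<open>The lower bound on \<open>q\<close> yields
        \<open>c * t \<le> q * ?m\<close>; the upper bound \<open>q < t\<close> makes
        \<open>g\<close> positive.\<close>
      have "c * t / ?m < t" "0 \<le> c * t / ?m" using c elim(2) by (simp_all add: field_simps)
      then obtain j l :: nat where jl: "c * t / ?m < real l / 2 ^ j" "real l / 2 ^ j < t"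
        using dyadic_between by blast
      define q where "q = real l / 2 ^ j"
      have q: "c * t / ?m < q" "q < t" "0 \<le> q" using jl by (simp_all add: q_def)
      then have q1: "q < 1 / 2" using elim(2) by linarith
      then have "real l / 2 ^ j < 1" unfolding q_def by linarith
      then have "real l < 2 ^ j" by (simp only: divide_less_eq_1_pos zero_less_power zero_less_numeral)
      then have l: "l \<le> 2 ^ j" by simp
      \<comment> \<open>Solves \<open>q * f z + (1 - q) * g z = t * (f z + \<eta>)\<close> for the
        second endpoint.\<close>
      define g where "g z = (t * (f z + \<eta>) - q * f z) / (1 - q)" for z
      have g: "g z \<in> I" if z: "z \<in> set xs" for z
      proof (rule interval_mem)
        have "q * f z \<le> t * f z" using q f0[OF z] by (intro mult_right_mono) auto
        moreover have "0 < t * \<eta>" using elim(2) assms(3) by simp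
        ultimately show "0 < g z" using q q1 unfolding g_def by (simp add: distrib_left)
        have "g z * (1 - q) \<le> t * (f z + \<eta>)" using q q1 f0[OF z] by (simp add: g_def)
        also have "\<dots> \<le> b / 2" using elim(1) z by auto
        also have "\<dots> \<le> b * (1 - q)" using q1 interval(5) by simp
        finally show "g z \<le> b" using q1 by simp
      qed
      have "q * ?m + (1 - q) * M (map g xs) \<le> M (map (\<lambda>z. q * f z + (1 - q) * g z) xs)"
        unfolding q_def by (rule dyadic_concave[OF assms(1) assms(2) g l])
      also have "(\<lambda>z. q * f z + (1 - q) * g z) = (\<lambda>z. t * (f z + \<eta>))"
        using q1 by (simp add: g_def fun_eq_iff)
      finally have "q * ?m + (1 - q) * M (map g xs) \<le> M (map (\<lambda>z. t * (f z + \<eta>)) xs)" .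
      moreover have "0 \<le> M (map g xs)"
        using g assms(1) by (intro mean_nonneg) (auto simp: tuples_def)
      then have "0 \<le> (1 - q) * M (map g xs)" using q1 by simp
      moreover have "c * t \<le> q * ?m" using q(1) c by (simp add: field_simps)
      ultimately show ?case by linarith
    qed
  qed
  show ?thesis
  proof (rule dense_le)
    fix c assume "c < ?m"
    moreover have "0 \<le> hom (map (\<lambda>z. f z + \<eta>) xs)"
      using assms(1) pos by (rule hom_nonneg)
    ultimately show "c \<le> hom (map (\<lambda>z. f z + \<eta>) xs)"
      using main[of c] by linarith
  qed
qed

end

section \<open>The Hardy constants\<close>

lemma sum_means_le:
  assumes "jensen_concave_mean_at_0 I M b" "symmetric_mean I M" "repetition_superinvariant I M"
    and x: "x \<in> tuples I" "length x = Suc m"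
  shows "(\<Sum>k=1..Suc m. M (take k x))
           \<le> real (Suc m) * repeated_mean (homogenization M) (Suc m) (\<lambda>i. 1 / real i) (\<lambda>i. fact m)
               * sum_list x"
proof -
  interpret jensen_concave_mean_at_0 I M b by fact
  let ?P = "block_positions m"
  let ?A = "{1..Suc m} \<times> {..<fact m :: nat}"
  let ?K = "hom (map (\<lambda>p. 1 / real (fst p)) ?P)"
  have K: "repeated_mean hom (Suc m) (\<lambda>i. 1 / real i) (\<lambda>i. fact m) = ?K"
    unfolding repeated_mean_def map_block_positions_const[of "\<lambda>i. 1 / real i" m] ..
  have xI: "x ! j \<in> I" if "j < Suc m" for j using x that by (auto simp: tuples_def)
  have x0: "0 \<le> x ! j" if "j < Suc m" for j using xI[OF that] interval_nonneg by auto
  have K0: "0 \<le> ?K"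
    by (intro hom_nonneg block_positions_nonempty) (auto simp: set_block_positions)
  \<comment> \<open>Of the \<open>m + 2\<close> copies of \<open>\<eta>\<close>,
    \<open>m + 1\<close> come from the shifted entries; the last makes the bound on partial sums
    strict, as \<open>hom_mono\<close> requires.\<close>
  have main: "(\<Sum>k=1..Suc m. M (take k x)) \<le> real (Suc m) * ?K * (sum_list x + real (m + 2) * \<eta>)"
    if \<eta>: "0 < \<eta>" for \<eta>
  proof -
    define u where "u j = x ! (j - 1) + \<eta>" for j
    define S where "S = sum_list x + real (m + 2) * \<eta>"
    have u0: "0 < u j" if "j \<in> {1..Suc m}" for j
      unfolding u_def using that \<eta> by (intro add_nonneg_pos x0) auto
    have rank: "rank_at m k s p \<in> {1..Suc m}" if "p \<in> set ?P" "k \<in> {1..Suc m}" for k s p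
      using rank_at_range[OF that, of s] that(2) by auto
    have S: "(\<Sum>j=1..i. u j) < S" if "i \<in> {1..Suc m}" for i
    proof -
      have "(\<Sum>j=1..i. u j) \<le> (\<Sum>j=1..Suc m. u j)"
        using that u0 by (intro sum_mono2) (auto intro: less_imp_le)
      also have "\<dots> = (\<Sum>j<Suc m. x ! j + \<eta>)"
        by (simp only: One_nat_def sum.atLeast1_atMost_eq) (simp add: u_def)
      also have "\<dots> = sum_list x + real (Suc m) * \<eta>"
        using x(2) by (simp add: sum.distrib sum_list_sum_nth atLeast0LessThan algebra_simps)
      also have "\<dots> < S" using \<eta> by (simp add: S_def algebra_simps)
      finally show ?thesis .
    qed
    have S0: "0 < S" using S[of 1] u0[of 1] by simp
    have step: "M (take k x) \<le> hom (map (\<lambda>p. u (rank_at m k s p)) ?P)" if k: "k \<in> {1..Suc m}" for k s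
    proof -
      let ?c = "fact (Suc m) div k"
      have "k \<le> fact (Suc m)" using k by (meson atLeastAtMost_iff fact_ge_self le_trans)
      then have c: "1 \<le> ?c" using k by (simp add: div_greater_zero_iff Suc_le_eq del: fact_Suc)
      have tk: "take k x \<in> tuples I"
        using x k set_take_subset[of k x] by (auto simp: tuples_def)
      have rI: "x ! (rank_at m k s p - 1) \<in> I" if "p \<in> set ?P" for p
        using rank[OF that k, of s] by (intro xI) auto
      have "M (take k x) \<le> M (concat (map (replicate ?c) (take k x)))"
        using assms(3) tk c unfolding repetition_superinvariant_def by blast
      also have "\<dots> = M (map (\<lambda>p. x ! (rank_at m k s p - 1)) ?P)"
      proof -
        have "map (\<lambda>p. x ! (rank_at m k s p - 1)) ?P \<in> tuples I"
          using rI block_positions_nonempty by (auto simp: tuples_def)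
        moreover have "k \<le> length x" using k x(2) by simp
        ultimately show ?thesis
          using assms(2) mset_rank_at[OF k, of x s, symmetric] unfolding symmetric_mean_def
          by blast
      qed
      also have "\<dots> \<le> hom (map (\<lambda>p. x ! (rank_at m k s p - 1) + \<eta>) ?P)"
        using rI \<eta> by (intro mean_le_hom_shift block_positions_nonempty)
      finally show ?thesis by (simp add: u_def)
    qed
    \<comment> \<open>Each mean is counted once per shift \<open>s\<close>, so that superadditivity
      over \<open>?A\<close> produces the block averages.\<close>
    have "fact m * (\<Sum>k=1..Suc m. M (take k x)) = (\<Sum>(k, s)\<in>?A. M (take k x))"
      by (simp add: sum.cartesian_product[symmetric] sum_distrib_left del: sum.cl_ivl_Suc)
    also have "\<dots> \<le> (\<Sum>a\<in>?A. hom (map (\<lambda>p. u (rank_at m (fst a) (snd a) p)) ?P))"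
      by (intro sum_mono) (auto intro!: step simp del: One_nat_def)
    also have "\<dots> \<le> hom (map (\<lambda>p. \<Sum>a\<in>?A. u (rank_at m (fst a) (snd a) p)) ?P)"
      using rank by (intro hom_sum_ge block_positions_nonempty u0) (auto simp: lessThan_empty_iff)
    also have "\<dots> = hom (map (\<lambda>p. fact (Suc m) / real (fst p) * (\<Sum>j=1..fst p. u j)) ?P)"
      using sum_rank_at[of _ m u] by (simp add: case_prod_beta' del: fact_Suc cong: map_cong)
    \<comment> \<open>Enlarging every partial sum to \<open>S\<close> leaves entries proportional to
      \<open>1 / i\<close>, and homogeneity extracts the factor.\<close>
    also have "\<dots> \<le> hom (map (\<lambda>p. fact (Suc m) * S * (1 / real (fst p))) ?P)"
    proof (rule hom_mono[OF block_positions_nonempty])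
      fix p assume "p \<in> set ?P"
      then have p: "fst p \<in> {1..Suc m}" by (auto simp: set_block_positions)
      have "0 < (\<Sum>j=1..fst p. u j)" using p u0 by (intro sum_pos) auto
      then show "0 < fact (Suc m) / real (fst p) * (\<Sum>j=1..fst p. u j)"
        using p by (intro mult_pos_pos divide_pos_pos) auto
      have "fact (Suc m) / real (fst p) * (\<Sum>j=1..fst p. u j) < fact (Suc m) / real (fst p) * S"
        using S[OF p] p by (intro mult_strict_left_mono) (auto simp del: fact_Suc)
      then show "fact (Suc m) / real (fst p) * (\<Sum>j=1..fst p. u j) < fact (Suc m) * S * (1 / real (fst p))"
        by simp
    qed
    also have "\<dots> = fact (Suc m) * S * ?K"
      using S0 by (intro hom_scale block_positions_nonempty) (auto simp: set_block_positions)
    also have "\<dots> = fact m * (real (Suc m) * ?K * S)" by (simp add: algebra_simps)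
    finally show ?thesis by (simp add: S_def del: of_nat_Suc sum.cl_ivl_Suc)
  qed
  have "((\<lambda>\<eta>. real (Suc m) * ?K * (sum_list x + real (m + 2) * \<eta>)) \<longlongrightarrow>
      real (Suc m) * ?K * (sum_list x + real (m + 2) * 0)) (at_right 0)"
    by (intro tendsto_intros)
  moreover have "eventually (\<lambda>\<eta>. (\<Sum>k=1..Suc m. M (take k x))
      \<le> real (Suc m) * ?K * (sum_list x + real (m + 2) * \<eta>)) (at_right 0)"
    using eventually_at_right_less[of "0::real"] by eventually_elim (rule main)
  ultimately have "(\<Sum>k=1..Suc m. M (take k x)) \<le> real (Suc m) * ?K * (sum_list x + real (m + 2) * 0)"
    by (intro tendsto_lowerbound) auto
  then show ?thesis unfolding K by simp
qed

theorem theorem1: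
  fixes I :: "real set" and M :: "real list \<Rightarrow> real"
  assumes "is_interval I" and "\<exists>a\<in>I. \<exists>b\<in>I. a < b"
    and "bdd_below I" and "Inf I = 0"
    and "is_mean I M"
    and "symmetric_mean I M"
    and "jensen_concave_mean I M"
    and "repetition_superinvariant I M"
  shows "(\<forall>n\<ge>1. hardy_const_n I M n
           \<le> real n * repeated_mean (homogenization M) n (\<lambda>i. 1 / real i) (\<lambda>i. fact (n - 1)))
    \<and> hardy_const I M
           \<le> liminf (\<lambda>n. ereal (real n *
               repeated_mean (homogenization M) n (\<lambda>i. 1 / real i) (\<lambda>i. fact (n - 1))))"
proof -
  obtain a b where ab: "a \<in> I" "b \<in> I" "a < b" using assms(2) by blast
  have "0 \<le> a" using cInf_lower[OF ab(1) assms(3)] assms(4) by simp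
  then have loc: "jensen_concave_mean_at_0 I M b"
    using assms ab by unfold_locales auto
  interpret jensen_concave_mean_at_0 I M b by (rule loc)
  define K where "K n = real n * repeated_mean hom n (\<lambda>i. 1 / real i) (\<lambda>i. fact (n - 1))" for n
  have le: "(\<Sum>k=1..n. M (take k x)) \<le> K n * sum_list x" if x: "x \<in> tuples I" "length x = n" "1 \<le> n" for x n
  proof -
    obtain m where "n = Suc m" using x(3) by (cases n) auto
    then show ?thesis
      using sum_means_le[OF loc assms(6,8), of x m] x by (simp add: K_def del: of_nat_Suc sum.cl_ivl_Suc)
  qed
  \<comment> \<open>Nonnegativity makes \<open>K n\<close> admissible in
    \<open>hardy_const_n\<close>; it follows from testing the bound on the constant tuple
    \<open>b\<close>.\<close>
  have K0: "0 \<le> K n" if n: "1 \<le> n" for n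
  proof -
    have x: "replicate n b \<in> tuples I" using n ab by (auto simp: tuples_def)
    have "0 \<le> M (take k (replicate n b))" if "k \<in> {1..n}" for k
      using that ab by (intro mean_nonneg) (auto simp: tuples_def)
    then have "0 \<le> (\<Sum>k=1..n. M (take k (replicate n b)))" by (rule sum_nonneg)
    also have "\<dots> \<le> K n * (real n * b)" using le[OF x _ n] by (simp add: sum_list_replicate)
    finally have "0 \<le> K n * (real n * b)" .
    moreover have "0 < real n * b" using n interval(5) by simp
    ultimately show ?thesis by (metis linorder_not_le mult_neg_pos)
  qed
  have "hardy_const_n I M n \<le> K n" if "1 \<le> n" for n
    unfolding hardy_const_n_def
    using le K0 that by (intro cInf_lower) (auto intro!: bdd_belowI[of _ 0])
  moreover have "hardy_const I M \<le> liminf (\<lambda>n. ereal (K n))"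
    unfolding hardy_const_def
  \<comment> \<open>The lower limit is itself an admissible constant: the partial sums converge in
    the extended reals, and each with \<open>n \<ge> 1\<close> obeys the finite bound on an initial
    segment of \<open>x\<close>.\<close>
  proof (intro Inf_lower CollectI allI impI)
    fix x :: "nat \<Rightarrow> real" assume x: "range x \<subseteq> I \<and> summable x"
    have x0: "0 \<le> x n" for n using x interval_nonneg by auto
    let ?S = "\<Sum>n. x n"
    let ?f = "\<lambda>n. ereal (M (map x [0..<Suc n]))"
    have f0: "0 \<le> ?f n" for n
      using x by (auto simp: tuples_def image_subset_iff simp del: upt_Suc intro!: mean_nonneg)
    have "(\<lambda>n. \<Sum>k<n. ?f k) \<longlonglongrightarrow> (\<Sum>n. ?f n)"
      using f0 by (intro summable_LIMSEQ summable_ereal_pos)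
    then have "(\<Sum>n. ?f n) = liminf (\<lambda>n. \<Sum>k<n. ?f k)"
      by (simp add: lim_imp_Liminf del: upt_Suc)
    also have "\<dots> \<le> liminf (\<lambda>n. ereal (K n) * ereal ?S)"
    proof (rule Liminf_mono)
      show "eventually (\<lambda>n. (\<Sum>k<n. ?f k) \<le> ereal (K n) * ereal ?S) sequentially"
        using eventually_ge_at_top[of 1]
      proof eventually_elim
        case (elim n)
        \<comment> \<open>Passes from indexing by the last entry, starting at 0, to indexing by
          length, starting at 1.\<close>
        have "(\<Sum>k<n. M (map x [0..<Suc k])) = (\<Sum>k=1..n. M (map x [0..<k]))"
          by (simp only: One_nat_def sum.atLeast1_atMost_eq)
        also have "\<dots> = (\<Sum>k=1..n. M (take k (map x [0..<n])))"
          by (intro sum.cong) (auto simp: take_map)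
        also have "\<dots> \<le> K n * sum_list (map x [0..<n])"
          using x elim by (intro le) (auto simp: tuples_def)
        also have "\<dots> \<le> K n * ?S"
          using x x0 elim K0[of n]
          by (intro mult_left_mono)
             (auto simp: interv_sum_list_conv_sum_set_nat intro!: sum_le_suminf)
        finally show ?case by (simp del: upt_Suc)
      qed
    qed
    \<comment> \<open>A finite nonnegative factor may be pulled out of the lower limit.\<close>
    also have "\<dots> = liminf (\<lambda>n. ereal (K n)) * ereal ?S"
      using x x0 by (intro Liminf_ereal_mult_right) (auto intro!: suminf_nonneg)
    finally show "(\<Sum>n. ?f n) \<le> liminf (\<lambda>n. ereal (K n)) * ereal ?S" .
  qed
  ultimately show ?thesis unfolding K_def by blast
qed

end
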